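(* Let $(X,d)$ be a complete $b$-metric space with coefficient $s \geq 1$ and let $E$ be a nonempty closed subset of $X$. Let $\mathfrak{F}$ be a nonempty set of mappings $f:\mathbb{N}_0\to\mathbb{N}_0$ with the shift property: if $f\in\mathfrak{F}$ and $p\in\mathbb{N}$, then $f_p\in\mathfrak{F}$, where $f_p(i)=f(i+p)$ for all $i\in\mathbb{N}_0$. For each $i\in\mathbb{N}_0$ let $T_i:X\to X$ be a weak quasi-contraction such that $T_i(E)\subset E$, and suppose that $$\operatorname{diam}\mathcal{O}_{T_{f(j)}}(T_{f(i)}x,T_{f(i)}y)\leq \operatorname{diam}\mathcal{O}_{T_{f(j)}}(x,y)\quad\text{for all } x,y\in X,\ f\in\mathfrak{F},\ i,j\in\mathbb{N}_0.$$ Suppose that for each $\epsilon>0$ there exists a natural number $n_\epsilon$ such that for each $f\in\mathfrak{F}$ and each $x\in X$, $$d(T_{f(n_\epsilon)}T_{f(n_\epsilon-1)}\cdots T_{f(1)}T_{f(0)}x,\,E)<\epsilon.$$ Then for each $\epsilon>0$ there exist $\delta>0$ and $n_0\in\mathbb{N}$ such that for each $f\in\mathfrak{F}$ and each sequence $\{x_i\}_{i=0}^\infty\subset X$ satisfying $$\operatorname{diam}\mathcal{O}_{T_{f(j)}}(x_{i+1},T_{f(i)}x_i)\leq\delta\quad\text{for all } i,j\in\mathbb{N}_0,$$ one has $d(x_i,E)<\epsilon$ for all $i\geq n_0$.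
   Context: $\mathbb{N}$ is the set of natural numbers (positive integers) and $\mathbb{N}_0=\mathbb{N}\cup\{0\}$. A $b$-metric space with coefficient $s\geq1$ is a nonempty set $X$ with $d:X\times X\to[0,\infty)$ such that for all $x,y,z\in X$: $d(x,y)=0$ iff $x=y$; $d(x,y)=d(y,x)$; $d(x,y)\leq s[d(x,z)+d(z,y)]$. A sequence $\{x_n\}$ converges to $x$ iff $d(x_n,x)\to0$; it is Cauchy iff $d(x_n,x_m)\to0$ as $n,m\to\infty$; $(X,d)$ is complete if every Cauchy sequence converges in $X$. For nonempty $A\subset X$, $d(x,A)=\inf\{d(x,y):y\in A\}$. For $T:X\to X$: $T^0$ is the identity, $T^{n+1}=T\circ T^n$, $\mathcal{O}_T(x)=\{T^nx:n\in\mathbb{N}_0\}$, $\mathcal{O}_T(x,y)=\mathcal{O}_T(x)\cup\mathcal{O}_T(y)$; $\operatorname{diam}A=\sup\{d(u,v):u,v\in A\}$. $T$ is a weak quasi-contraction if every orbit $\mathcal{O}_T(x)$ is bounded and $d(Tx,Ty)\leq\psi(\operatorname{diam}\mathcal{O}_T(x,y))$ for all $x,y\in X$, for some $\psi:[0,\infty)\to[0,\infty)$ that is increasing and upper semi-continuous with $\psi(0)=0$ and $\psi(t)<t$ for all $t>0$. *)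

theory Defs
  imports "HOL-Analysis.Analysis"
begin

text \<open>The space is a carrier set \<open>X\<close> with a distance \<open>d\<close> whose values matter only on \<open>X \<times> X\<close>.\<close>

definition b_metric_space :: "'a set \<Rightarrow> ('a \<Rightarrow> 'a \<Rightarrow> real) \<Rightarrow> real \<Rightarrow> bool" where
  "b_metric_space X d s \<longleftrightarrow>
     X \<noteq> {} \<and> s \<ge> 1 \<and>
     (\<forall>x\<in>X. \<forall>y\<in>X. 0 \<le> d x y) \<and>
     (\<forall>x\<in>X. \<forall>y\<in>X. d x y = 0 \<longleftrightarrow> x = y) \<and>
     (\<forall>x\<in>X. \<forall>y\<in>X. d x y = d y x) \<and>
     (\<forall>x\<in>X. \<forall>y\<in>X. \<forall>z\<in>X. d x y \<le> s * (d x z + d z y))"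

definition b_converges :: "('a \<Rightarrow> 'a \<Rightarrow> real) \<Rightarrow> (nat \<Rightarrow> 'a) \<Rightarrow> 'a \<Rightarrow> bool" where
  "b_converges d u x \<longleftrightarrow> (\<lambda>n. d (u n) x) \<longlonglongrightarrow> 0"

definition b_Cauchy :: "('a \<Rightarrow> 'a \<Rightarrow> real) \<Rightarrow> (nat \<Rightarrow> 'a) \<Rightarrow> bool" where
  "b_Cauchy d u \<longleftrightarrow> (\<forall>\<epsilon>>0. \<exists>N. \<forall>n\<ge>N. \<forall>m\<ge>N. d (u n) (u m) < \<epsilon>)"

definition b_complete :: "'a set \<Rightarrow> ('a \<Rightarrow> 'a \<Rightarrow> real) \<Rightarrow> bool" where
  "b_complete X d \<longleftrightarrow>
     (\<forall>u. (\<forall>n. u n \<in> X) \<and> b_Cauchy d u \<longrightarrow> (\<exists>x\<in>X. b_converges d u x))"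

text \<open>Sequential closedness. In a \<open>b\<close>-metric space it agrees with closedness in the topology whose
  open sets are those containing a ball around each of their points (balls need not be open).\<close>

definition b_closed :: "'a set \<Rightarrow> ('a \<Rightarrow> 'a \<Rightarrow> real) \<Rightarrow> 'a set \<Rightarrow> bool" where
  "b_closed X d E \<longleftrightarrow>
     E \<subseteq> X \<and> (\<forall>u. \<forall>x\<in>X. (\<forall>n. u n \<in> E) \<and> b_converges d u x \<longrightarrow> x \<in> E)"

definition b_bounded :: "('a \<Rightarrow> 'a \<Rightarrow> real) \<Rightarrow> 'a set \<Rightarrow> bool" where
  "b_bounded d A \<longleftrightarrow> (\<exists>M. \<forall>u\<in>A. \<forall>v\<in>A. d u v \<le> M)"

text \<open>The supremum below is real-valued, so it is meaningful only for bounded nonempty sets. It is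
  used only for \<open>orbit2 T x y\<close> with all orbits of \<open>T\<close> bounded; by the relaxed triangle
  inequality these unions are then bounded too.\<close>

definition b_diam :: "('a \<Rightarrow> 'a \<Rightarrow> real) \<Rightarrow> 'a set \<Rightarrow> real" where
  "b_diam d A = Sup {d u v | u v. u \<in> A \<and> v \<in> A}"

definition dist_to_set :: "('a \<Rightarrow> 'a \<Rightarrow> real) \<Rightarrow> 'a \<Rightarrow> 'a set \<Rightarrow> real" where
  "dist_to_set d x A = Inf {d x y | y. y \<in> A}"

definition orbit :: "('a \<Rightarrow> 'a) \<Rightarrow> 'a \<Rightarrow> 'a set" where
  "orbit T x = {(T ^^ n) x | n. True}"

definition orbit2 :: "('a \<Rightarrow> 'a) \<Rightarrow> 'a \<Rightarrow> 'a \<Rightarrow> 'a set" where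
  "orbit2 T x y = orbit T x \<union> orbit T y"

definition upper_semicontinuous_on :: "real set \<Rightarrow> (real \<Rightarrow> real) \<Rightarrow> bool" where
  "upper_semicontinuous_on S \<psi> \<longleftrightarrow>
     (\<forall>t\<in>S. \<forall>c>\<psi> t. eventually (\<lambda>r. \<psi> r < c) (at t within S))"

definition weak_quasi_contraction :: "'a set \<Rightarrow> ('a \<Rightarrow> 'a \<Rightarrow> real) \<Rightarrow> ('a \<Rightarrow> 'a) \<Rightarrow> bool" where
  "weak_quasi_contraction X d T \<longleftrightarrow>
     T \<in> X \<rightarrow> X \<and>
     (\<forall>x\<in>X. b_bounded d (orbit T x)) \<and>
     (\<exists>\<psi>::real \<Rightarrow> real.
        \<psi> \<in> {0..} \<rightarrow> {0..} \<and> mono_on {0..} \<psi> \<and> upper_semicontinuous_on {0..} \<psi> \<and>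
        \<psi> 0 = 0 \<and> (\<forall>t>0. \<psi> t < t) \<and>
        (\<forall>x\<in>X. \<forall>y\<in>X. d (T x) (T y) \<le> \<psi> (b_diam d (orbit2 T x y))))"

text \<open>\<open>iter_along T f n x\<close> is the product of the \<open>n + 1\<close> maps \<open>T (f n), \<dots>, T (f 0)\<close>
  applied to \<open>x\<close>.\<close>

primrec iter_along :: "(nat \<Rightarrow> 'a \<Rightarrow> 'a) \<Rightarrow> (nat \<Rightarrow> nat) \<Rightarrow> nat \<Rightarrow> 'a \<Rightarrow> 'a" where
  "iter_along T f 0 x = T (f 0) x"
| "iter_along T f (Suc n) x = T (f (Suc n)) (iter_along T f n x)"

end

theory Submission
  imports Defs
begin

text \<open>The diameter \<open>b_diam d (orbit2 T x y)\<close> satisfies the same relaxed triangle inequality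
  in \<open>x\<close>, \<open>y\<close> as \<open>d\<close>. Hence an inexact orbit with error \<open>\<delta>\<close> stays within
  \<open>(2 s)^n \<delta>\<close> of the exact orbit restarted \<open>n + 1\<close> steps earlier, since each exact step does
  not increase this diameter. By the shift property the restarted exact orbit is close to \<open>E\<close>
  after a number of steps that depends neither on \<open>f\<close> nor on the starting point.\<close>

section \<open>Diameters and bounded sets in a b-metric space\<close>

lemma b_metric_spaceD:
  assumes "b_metric_space X d s"
  shows b_metric_space_coeff: "s \<ge> 1"
    and b_metric_space_nonneg: "x \<in> X \<Longrightarrow> y \<in> X \<Longrightarrow> 0 \<le> d x y"
    and b_metric_space_sym: "x \<in> X \<Longrightarrow> y \<in> X \<Longrightarrow> d x y = d y x"
    and b_metric_space_triangle:
      "x \<in> X \<Longrightarrow> y \<in> X \<Longrightarrow> z \<in> X \<Longrightarrow> d x y \<le> s * (d x z + d z y)"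
  using assms unfolding b_metric_space_def by meson+

lemma b_diam_upper:
  assumes "b_bounded d A" and "u \<in> A" and "v \<in> A"
  shows "d u v \<le> b_diam d A"
proof -
  have "bdd_above {d u v | u v. u \<in> A \<and> v \<in> A}"
    using assms(1) unfolding b_bounded_def bdd_above_def by blast
  then show ?thesis
    unfolding b_diam_def using assms(2,3) by (intro cSup_upper) auto
qed

lemma b_diam_least:
  assumes "A \<noteq> {}" and "\<And>u v. u \<in> A \<Longrightarrow> v \<in> A \<Longrightarrow> d u v \<le> c"
  shows "b_diam d A \<le> c"
proof -
  have "{d u v | u v. u \<in> A \<and> v \<in> A} \<noteq> {}" using assms(1) by blast
  then show ?thesis
    unfolding b_diam_def by (rule cSup_least) (use assms(2) in auto)
qed

lemma b_bounded_Un: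
  assumes "b_metric_space X d s" and "b_bounded d A" and "b_bounded d B"
    and "A \<subseteq> X" and "B \<subseteq> X"
  shows "b_bounded d (A \<union> B)"
proof (cases "A = {} \<or> B = {}")
  case True
  with assms(2,3) show ?thesis by auto
next
  case False
  then obtain a b where ab: "a \<in> A" "b \<in> B" by blast
  obtain M where M: "\<And>u v. u \<in> A \<Longrightarrow> v \<in> A \<Longrightarrow> d u v \<le> M"
    using assms(2) unfolding b_bounded_def by blast
  obtain N where N: "\<And>u v. u \<in> B \<Longrightarrow> v \<in> B \<Longrightarrow> d u v \<le> N"
    using assms(3) unfolding b_bounded_def by blast
  have s: "s \<ge> 1" using b_metric_space_coeff[OF assms(1)] .
  \<comment> \<open>The bound for the path from u through a and b to v: each of the two intermediate
    points costs one factor s.\<close>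
  define K where "K = s * (M + s * (d a b + N))"
  have across: "d u v \<le> K" if "u \<in> A" "v \<in> B" for u v
  proof -
    have "d a v \<le> s * (d a b + d b v)"
      using b_metric_space_triangle[OF assms(1)] assms(4,5) ab that by blast
    also have "\<dots> \<le> s * (d a b + N)"
      using N[OF ab(2) that(2)] s by (intro mult_left_mono) auto
    finally have av: "d a v \<le> s * (d a b + N)" .
    have "d u v \<le> s * (d u a + d a v)"
      using b_metric_space_triangle[OF assms(1)] assms(4,5) ab that by blast
    also have "\<dots> \<le> K"
      unfolding K_def using M[OF that(1) ab(1)] av s by (intro mult_left_mono) auto
    finally show ?thesis .
  qed
  have "d u v \<le> max K (max M N)" if "u \<in> A \<union> B" "v \<in> A \<union> B" for u v
  proof -
    have "u \<in> X" "v \<in> X" using that assms(4,5) by blast+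
    then have "d u v = d v u" by (rule b_metric_space_sym[OF assms(1)])
    then have "d u v \<le> K \<or> d u v \<le> M \<or> d u v \<le> N"
      using that M[of u v] N[of u v] across[of u v] across[of v u] by auto
    then show ?thesis by auto
  qed
  then show ?thesis unfolding b_bounded_def by blast
qed

section \<open>Diameters of unions of two orbits\<close>

lemma self_in_orbit: "x \<in> orbit T x"
proof -
  have "x = (T ^^ 0) x" by simp
  then show ?thesis unfolding orbit_def by blast
qed

lemma orbit_subset:
  assumes "T \<in> X \<rightarrow> X" and "x \<in> X"
  shows "orbit T x \<subseteq> X"
proof -
  have "(T ^^ n) x \<in> X" for n
    using assms by (induction n) auto
  then show ?thesis unfolding orbit_def by blast
qed

lemma weak_quasi_contraction_maps:
  "weak_quasi_contraction X d T \<Longrightarrow> T \<in> X \<rightarrow> X"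
  unfolding weak_quasi_contraction_def by blast

text \<open>The real supremum in \<open>b_diam\<close> is an upper bound for the distances only when
  these are bounded, and a weak quasi-contraction provides boundedness of single orbits
  only.\<close>

lemma b_bounded_orbit2:
  assumes "b_metric_space X d s" and "weak_quasi_contraction X d T" and "x \<in> X" and "y \<in> X"
  shows "b_bounded d (orbit2 T x y)"
proof -
  have "b_bounded d (orbit T x)" "b_bounded d (orbit T y)"
    using assms(2-4) unfolding weak_quasi_contraction_def by blast+
  then show ?thesis
    unfolding orbit2_def
    by (intro b_bounded_Un[OF assms(1)] orbit_subset[OF weak_quasi_contraction_maps[OF assms(2)]]
        assms(3,4))
qed

lemma b_diam_orbit2_nonneg:
  assumes "b_metric_space X d s" and "weak_quasi_contraction X d T" and "x \<in> X" and "y \<in> X"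
  shows "0 \<le> b_diam d (orbit2 T x y)"
proof -
  have "0 \<le> d x y" using b_metric_space_nonneg[OF assms(1,3,4)] .
  also have "\<dots> \<le> b_diam d (orbit2 T x y)"
    by (intro b_diam_upper b_bounded_orbit2[OF assms]) (auto simp: orbit2_def self_in_orbit)
  finally show ?thesis .
qed

text \<open>Two points on the same orbit lie in one of the two unions on the right. Points on
  different orbits are compared through z itself, which belongs to both unions.\<close>

lemma b_diam_orbit2_triangle:
  assumes b: "b_metric_space X d s" and T: "weak_quasi_contraction X d T"
    and X: "x \<in> X" "y \<in> X" "z \<in> X"
  shows "b_diam d (orbit2 T x y) \<le> s * (b_diam d (orbit2 T x z) + b_diam d (orbit2 T z y))"
    (is "_ \<le> s * (?D + ?D')")
proof (rule b_diam_least)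
  show "orbit2 T x y \<noteq> {}" using self_in_orbit[of x T] unfolding orbit2_def by blast
  fix u v assume uv: "u \<in> orbit2 T x y" "v \<in> orbit2 T x y"
  have s: "s \<ge> 1" using b_metric_space_coeff[OF b] .
  have D: "0 \<le> ?D" "0 \<le> ?D'" using b_diam_orbit2_nonneg[OF b T] X by blast+
  have le: "d a b \<le> ?D" if "a \<in> orbit T x \<union> orbit T z" "b \<in> orbit T x \<union> orbit T z" for a b
    using b_diam_upper[OF b_bounded_orbit2[OF b T X(1,3)]] that unfolding orbit2_def by blast
  have le': "d a b \<le> ?D'" if "a \<in> orbit T z \<union> orbit T y" "b \<in> orbit T z \<union> orbit T y" for a b
    using b_diam_upper[OF b_bounded_orbit2[OF b T X(3,2)]] that unfolding orbit2_def by blast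
  have sub: "orbit T x \<subseteq> X" "orbit T y \<subseteq> X"
    using orbit_subset[OF weak_quasi_contraction_maps[OF T]] X by blast+
  have across: "d a b \<le> s * (?D + ?D')" if "a \<in> orbit T x" "b \<in> orbit T y" for a b
  proof -
    have "d a b \<le> s * (d a z + d z b)"
      using b_metric_space_triangle[OF b] that sub X(3) by blast
    also have "\<dots> \<le> s * (?D + ?D')"
      using le[of a z] le'[of z b] that s self_in_orbit[of z T]
      by (intro mult_left_mono add_mono) auto
    finally show ?thesis .
  qed
  \<comment> \<open>Pairs on the same orbit are bounded by a single diameter without the factor s;
    since s \<ge> 1 and both diameters are nonnegative, this bound can be enlarged to the common
    one.\<close>
  have expand: "?D + ?D' \<le> s * (?D + ?D')"
    using mult_right_mono[of 1 s "?D + ?D'"] s D by simp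
  consider "u \<in> orbit T x" "v \<in> orbit T x" | "u \<in> orbit T y" "v \<in> orbit T y"
    | "u \<in> orbit T x" "v \<in> orbit T y" | "u \<in> orbit T y" "v \<in> orbit T x"
    using uv unfolding orbit2_def by blast
  then show "d u v \<le> s * (?D + ?D')"
  proof cases
    case 1
    then show ?thesis using le[of u v] D expand by simp
  next
    case 2
    then show ?thesis using le'[of u v] D expand by simp
  next
    case 3
    then show ?thesis by (rule across)
  next
    case 4
    then have "u \<in> X" "v \<in> X" using sub by blast+
    then have "d u v = d v u" by (rule b_metric_space_sym[OF b])
    then show ?thesis using across[OF 4(2,1)] by simp
  qed
qed

section \<open>Distance to a set\<close>

lemma dist_to_set_le:
  assumes "b_metric_space X d s" and "x \<in> X" and "E \<subseteq> X" and "e \<in> E"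
  shows "dist_to_set d x E \<le> d x e"
proof -
  have "bdd_below {d x y | y. y \<in> E}"
    using b_metric_space_nonneg[OF assms(1,2)] assms(3) by (intro bdd_belowI[of _ 0]) auto
  then show ?thesis
    unfolding dist_to_set_def using assms(4) by (intro cInf_lower) auto
qed

lemma dist_to_set_less_obtain:
  assumes "E \<noteq> {}" and "dist_to_set d x E < c"
  obtains e where "e \<in> E" and "d x e < c"
proof -
  have "{d x y | y. y \<in> E} \<noteq> {}" using assms(1) by blast
  from cInf_lessD[OF this] show ?thesis
    using assms(2) that unfolding dist_to_set_def by blast
qed

section \<open>Inexact orbits compared with exact ones\<close>

lemma iter_along_in:
  assumes "\<And>i. T i \<in> X \<rightarrow> X" and "x \<in> X"
  shows "iter_along T f n x \<in> X"
  using assms by (induction n) (auto simp: Pi_iff)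

text \<open>The induction cannot start from the empty product: \<open>orbit2 T x x\<close> is a whole orbit, whose
  diameter is not controlled by \<open>\<delta>\<close>.\<close>

lemma inexact_orbit_near_exact_orbit:
  fixes f :: "nat \<Rightarrow> nat" and x :: "nat \<Rightarrow> 'a"
  assumes b: "b_metric_space X d s" and T: "\<And>i. weak_quasi_contraction X d (T i)"
    and nonexp: "\<And>x y i j. x \<in> X \<Longrightarrow> y \<in> X \<Longrightarrow>
      b_diam d (orbit2 (T (f j)) (T (f i) x) (T (f i) y)) \<le> b_diam d (orbit2 (T (f j)) x y)"
    and x: "\<And>i. x i \<in> X"
    and err: "\<And>i j. b_diam d (orbit2 (T (f j)) (x (Suc i)) (T (f i) (x i))) \<le> \<delta>"
    and \<delta>: "0 \<le> \<delta>"
  shows "b_diam d (orbit2 (T (f j)) (x (Suc (n + p))) (iter_along T (\<lambda>i. f (i + p)) n (x p)))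
    \<le> (2 * s) ^ n * \<delta>"
proof (induction n)
  case 0
  \<comment> \<open>\<open>iter_along\<close> at 0 already applies one map, so this is the error
    hypothesis at index p.\<close>
  show ?case using err by simp
next
  case (Suc n)
  have s: "s \<ge> 1" using b_metric_space_coeff[OF b] .
  have T': "T i \<in> X \<rightarrow> X" for i using weak_quasi_contraction_maps[OF T] .
  define y where "y = iter_along T (\<lambda>i. f (i + p)) n (x p)"
  define q where "q = Suc (n + p)"
  have y: "y \<in> X" unfolding y_def using iter_along_in[OF T' x] .
  \<comment> \<open>The intermediate point is the exact image of \<open>x q\<close>. The first term
    is the new error; the second is the old discrepancy after applying the same map to both points,
    which does not increase it. The index j stays fixed throughout the induction.\<close>
  have "b_diam d (orbit2 (T (f j)) (x (Suc q)) (T (f q) y))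
      \<le> s * (b_diam d (orbit2 (T (f j)) (x (Suc q)) (T (f q) (x q)))
           + b_diam d (orbit2 (T (f j)) (T (f q) (x q)) (T (f q) y)))"
    using b_diam_orbit2_triangle[OF b T] x y T' by (simp add: Pi_iff)
  also have "\<dots> \<le> s * (\<delta> + (2 * s) ^ n * \<delta>)"
    using err[of j q] nonexp[OF x[of q] y, of j q] Suc.IH s
    unfolding y_def[symmetric] q_def[symmetric] by (intro mult_left_mono add_mono) auto
  \<comment> \<open>As 2 s \<ge> 1, the new error is at most the inherited bound, so one step costs
    exactly a factor 2 s.\<close>
  also have "\<dots> \<le> s * ((2 * s) ^ n * \<delta> + (2 * s) ^ n * \<delta>)"
    using s \<delta> mult_right_mono[of 1 "(2 * s) ^ n" \<delta>] one_le_power[of "2 * s" n]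
    by (intro mult_left_mono add_right_mono) auto
  also have "\<dots> = (2 * s) ^ Suc n * \<delta>" by simp
  finally show ?case unfolding y_def q_def by simp
qed

theorem theorem2p1:
  fixes X E :: "'a set" and d :: "'a \<Rightarrow> 'a \<Rightarrow> real" and s :: real
    and F :: "(nat \<Rightarrow> nat) set" and T :: "nat \<Rightarrow> 'a \<Rightarrow> 'a"
  assumes "b_metric_space X d s" and "b_complete X d"
    and "E \<noteq> {}" and "b_closed X d E"
    and "F \<noteq> {}"
    and "\<And>f p. f \<in> F \<Longrightarrow> p \<ge> 1 \<Longrightarrow> (\<lambda>i. f (i + p)) \<in> F"
    and "\<And>i. weak_quasi_contraction X d (T i)"
    and "\<And>i. T i ` E \<subseteq> E"
    and "\<And>x y f i j. x \<in> X \<Longrightarrow> y \<in> X \<Longrightarrow> f \<in> F \<Longrightarrow>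
           b_diam d (orbit2 (T (f j)) (T (f i) x) (T (f i) y)) \<le> b_diam d (orbit2 (T (f j)) x y)"
    and "\<And>\<epsilon>::real. \<epsilon> > 0 \<Longrightarrow>
           \<exists>n\<ge>1. \<forall>f\<in>F. \<forall>x\<in>X. dist_to_set d (iter_along T f n x) E < \<epsilon>"
  shows "\<forall>\<epsilon>>0. \<exists>\<delta>>0. \<exists>n0\<ge>1. \<forall>f\<in>F. \<forall>x :: nat \<Rightarrow> 'a.
           (\<forall>i. x i \<in> X) \<and>
           (\<forall>i j. b_diam d (orbit2 (T (f j)) (x (Suc i)) (T (f i) (x i))) \<le> \<delta>) \<longrightarrow>
           (\<forall>i\<ge>n0. dist_to_set d (x i) E < \<epsilon>)"
proof (intro allI impI)
  fix \<epsilon> :: real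
  assume \<epsilon>: "\<epsilon> > 0"
  note b = assms(1)
  have s: "s \<ge> 1" using b_metric_space_coeff[OF b] .
  have T: "T i \<in> X \<rightarrow> X" for i using weak_quasi_contraction_maps[OF assms(7)] .
  have E: "E \<subseteq> X" using assms(4) unfolding b_closed_def by blast
  \<comment> \<open>The last estimate passes through one intermediate point, so two terms of this
    size, multiplied by s, add up to \<epsilon>.\<close>
  have "\<epsilon> / (2 * s) > 0" using \<epsilon> s by simp
  from assms(10)[OF this] obtain n
    where n: "\<And>f x. f \<in> F \<Longrightarrow> x \<in> X \<Longrightarrow> dist_to_set d (iter_along T f n x) E < \<epsilon> / (2 * s)"
    by blast
  \<comment> \<open>Chosen so that the error accumulated over n steps, (2 s)^n \<delta>, equals
    \<epsilon> / (2 s). Both n and \<delta> are fixed before f and the sequence.\<close>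
  define \<delta> where "\<delta> = \<epsilon> / (2 * s) / (2 * s) ^ n"
  have \<delta>: "\<delta> > 0" unfolding \<delta>_def using \<epsilon> s by simp
  have "dist_to_set d (x i) E < \<epsilon>"
    if f: "f \<in> F" and x: "\<And>i. x i \<in> X"
      and err: "\<And>i j. b_diam d (orbit2 (T (f j)) (x (Suc i)) (T (f i) (x i))) \<le> \<delta>"
      and i: "i \<ge> Suc n" for f i and x :: "nat \<Rightarrow> 'a"
  proof -
    \<comment> \<open>The exact orbit is restarted at \<open>x p\<close>. It takes n + 1 maps to
      reach index i, hence the threshold \<open>Suc n\<close>.\<close>
    define p where "p = i - Suc n"
    have ip: "i = Suc (n + p)" using i unfolding p_def by simp
    define y where "y = iter_along T (\<lambda>i. f (i + p)) n (x p)"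
    have y: "y \<in> X" unfolding y_def using iter_along_in[OF T x] .
    \<comment> \<open>The shift property covers p \<ge> 1; for p = 0 the shifted map is f
      itself.\<close>
    have "(\<lambda>i. f (i + p)) \<in> F" using assms(6)[OF f, of p] f by (cases p) auto
    from n[OF this x] have "dist_to_set d y E < \<epsilon> / (2 * s)" unfolding y_def .
    \<comment> \<open>The infimum need not be attained, so a point of E that is merely close enough
      to y is taken.\<close>
    then obtain e where e: "e \<in> E" "d y e < \<epsilon> / (2 * s)"
      by (rule dist_to_set_less_obtain[OF assms(3)])
    \<comment> \<open>Each point lies on its own orbit, so the diameter bounds their distance. Any
      index j would serve here; 0 is one choice.\<close>
    have "d (x i) y \<le> b_diam d (orbit2 (T (f 0)) (x i) y)"
      by (intro b_diam_upper b_bounded_orbit2[OF b assms(7) x y])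
        (auto simp: orbit2_def self_in_orbit)
    also have "\<dots> \<le> (2 * s) ^ n * \<delta>"
      unfolding ip y_def
      using inexact_orbit_near_exact_orbit[where f = f, OF b assms(7) assms(9)[OF _ _ f] x err] \<delta>
      by simp
    also have "\<dots> = \<epsilon> / (2 * s)" unfolding \<delta>_def using s by simp
    finally have xy: "d (x i) y \<le> \<epsilon> / (2 * s)" .
    have "dist_to_set d (x i) E \<le> d (x i) e" using dist_to_set_le[OF b x E e(1)] .
    also have "\<dots> \<le> s * (d (x i) y + d y e)"
      using b_metric_space_triangle[OF b x _ y] e(1) E by blast
    also have "\<dots> < s * (\<epsilon> / (2 * s) + \<epsilon> / (2 * s))"
      using xy e(2) s by (intro mult_strict_left_mono) auto
    also have "\<dots> = \<epsilon>" using s by (simp add: field_simps)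
    finally show ?thesis .
  qed
  then show "\<exists>\<delta>>0. \<exists>n0\<ge>1. \<forall>f\<in>F. \<forall>x :: nat \<Rightarrow> 'a.
           (\<forall>i. x i \<in> X) \<and>
           (\<forall>i j. b_diam d (orbit2 (T (f j)) (x (Suc i)) (T (f i) (x i))) \<le> \<delta>) \<longrightarrow>
           (\<forall>i\<ge>n0. dist_to_set d (x i) E < \<epsilon>)"
    using \<delta> by (intro exI[of _ \<delta>] conjI exI[of _ "Suc n"]) auto
qed

end
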